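(* Let $A$ and $M$ be two vector spaces, and let $\mu\in\mathrm{Hom}(A^{\otimes2},A)$, $l\in\mathrm{Hom}(A\otimes M,M)$, $r\in\mathrm{Hom}(M\otimes A,M)$ and $T_1,T_2\in\mathrm{Hom}(M,A)$. Put $\pi=\mu+l+r\in V'_1$. Then $(A=(A,\mu),M=(M,l,r),(T_1,T_2))$ is a compatible $\mathcal{O}$-operator algebra if and only if $(\pi[1],(T_1,T_2))\in(V'[1]\oplus\mathfrak{a}_c)_0$ is a Maurer-Cartan element in the $L_\infty$-algebra $(V'[1]\oplus\mathfrak{a}_c,\{\widetilde l_k\}_{k=1}^\infty)$.
   Context: All vector spaces are over a field $\mathbf{k}$ of characteristic $0$. Compatible $\mathcal{O}$-operator algebras. $(A,M,(T_1,T_2))$ is a compatible $\mathcal{O}$-operator algebra if $(A,\mu)$ is an associative algebra, $(M,l,r)$ is an $A$-bimodule (write $\cdot$ for $\mu,l,r$), and $(T_1,T_2)$ is a compatible $\mathcal{O}$-operator on $M$ over $A$: $T_i(u)\cdot T_i(v)=T_i(T_i(u)\cdot v+u\cdot T_i(v))$ for $i=1,2$, and $$T_1(u)\cdot T_2(v)+T_2(u)\cdot T_1(v)=T_1(T_2(u)\cdot v+u\cdot T_2(v))+T_2(T_1(u)\cdot v+u\cdot T_1(v)),\quad u,v\in M.$$ $L_\infty$-algebras. An $L_\infty$-algebra is a graded vector space $L$ with degree $1$ maps $l_k:L^{\otimes k}\to L$, $k\ge1$, that are graded symmetric and satisfy, for all $n\ge 1$, $\sum_{i+j=n+1}\sum_{\sigma}\epsilon(\sigma)l_j(l_i(x_{\sigma(1)},\ldots,x_{\sigma(i)}),x_{\sigma(i+1)},\ldots,x_{\sigma(n)})=0$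 (sum over $(i,n-i)$-shuffles, $\epsilon(\sigma)$ the Koszul sign). A Maurer-Cartan element is $\alpha\in L_0$ with $\sum_{k\ge1}\frac1{k!}l_k(\alpha,\ldots,\alpha)=0$. The spaces. Let $V=\bigoplus_{n\ge0}V_n$, $V_n=\mathrm{Hom}((A\oplus M)^{\otimes n+1},A\oplus M)$, with the Gerstenhaber bracket, for $f\in V_m$, $g\in V_n$, $$[f,g]_{\mathsf G}=\sum_{i=1}^{m+1}(-1)^{(i-1)n}f\circ_ig-(-1)^{mn}\sum_{i=1}^{n+1}(-1)^{(i-1)m}g\circ_if,$$ $(f\circ_ig)(v_1,\ldots,v_{m+n+1})=f(v_1,\ldots,v_{i-1},g(v_i,\ldots,v_{i+n}),\ldots,v_{m+n+1})$. Let $\mathcal{A}^{p,q}$ be the sum of all tensor products of $p$ copies of $A$ and $q$ copies of $M$ (in any order), so $(A\oplus M)^{\otimes n+1}\cong\bigoplus_{p+q=n+1}\mathcal{A}^{p,q}$. Let $V'_n\subset V_n$ be the set of $f$ with $f(\mathcal{A}^{n+1,0})\subset A$, $f(\mathcal{A}^{n,1})\subset M$ and $f=0$ on the other $\mathcal{A}^{p,q}$, so $V'_n\cong \mathrm{Hom}(A^{\otimes n+1},A)\oplus\mathrm{Hom}(\mathcal{A}^{n,1},M)$; $V'=\bigoplus_{n\geq 0} V'_n$ is a graded Lie subalgebra. Let $\mathfrak{a}_n=\mathrm{Hom}(M^{\otimes n+1},A)\subset V_n$ (extended by zero), $\mathfrak{a}=\bigoplus_{n\ge0}\mathfrak{a}_n$,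 and $P:V\to\mathfrak{a}$ the projection onto the component $M^{\otimes n+1}\to A$. Put $$(V'[1]\oplus\mathfrak{a}_c)_i=V'_{i+1}\oplus(\mathfrak{a}_c)_i,\quad i\ge-1,\qquad(\mathfrak{a}_c)_i=\underbrace{\mathfrak{a}_i\oplus\cdots\oplus\mathfrak{a}_i}_{i+2},\qquad\mathfrak{a}_{-1}=0;$$ $f[1]$ denotes $f\in V'$ regarded in $V'[1]$. The operations $\widetilde l_k$. For $f\in V'_m$, $g\in V'$: $\widetilde l_2(f[1],g[1])=(-1)^{m}[f,g]_{\mathsf G}[1]$. For $f\in V'_n$ and $\theta^{(s)}=(\theta^{(s)}_1,\ldots,\theta^{(s)}_{i_s+2})\in(\mathfrak{a}_c)_{i_s}$, $s=1,\ldots,n+1$, $\widetilde l_{n+2}(f[1],\theta^{(1)},\ldots,\theta^{(n+1)})\in(\mathfrak{a}_c)_{n+i_1+\cdots+i_{n+1}}$ has $p$-th entry ($1\le p\le n+2+\sum_s i_s$) $$\sum_{j_1+\cdots+j_{n+1}=p+n}P[\cdots[[f,\theta^{(1)}_{j_1}]_{\mathsf G},\theta^{(2)}_{j_2}]_{\mathsf G},\ldots,\theta^{(n+1)}_{j_{n+1}}]_{\mathsf G},\qquad 1\le j_s\le i_s+2.$$ Up to graded-symmetric permutation of the arguments all other operations vanish. *)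

theory Defs
  imports "HOL-Analysis.Product_Vector" "HOL-Library.Function_Algebras"
begin

text \<open>
  Vector spaces over a field of characteristic 0 are types of class \<^class>\<open>ab_group_add\<close> together
  with a scalar multiplication \<open>sA\<close>, \<open>sM\<close> satisfying the locale \<^locale>\<open>vector_space\<close>.  The direct
  sum of \<open>A\<close> and \<open>M\<close> is the product type, and a linear map on a tensor product is given as the
  corresponding multilinear map.
\<close>

definition bilin ::
  "('k::field \<Rightarrow> 'a::ab_group_add \<Rightarrow> 'a) \<Rightarrow> ('k \<Rightarrow> 'b::ab_group_add \<Rightarrow> 'b) \<Rightarrow>
   ('k \<Rightarrow> 'c::ab_group_add \<Rightarrow> 'c) \<Rightarrow> ('a \<Rightarrow> 'b \<Rightarrow> 'c) \<Rightarrow> bool"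
  where "bilin s1 s2 s3 f \<longleftrightarrow>
    (\<forall>x. Vector_Spaces.linear s2 s3 (\<lambda>y. f x y)) \<and> (\<forall>y. Vector_Spaces.linear s1 s3 (\<lambda>x. f x y))"


section \<open>Compatible O-operator algebras\<close>

definition assoc_algebra ::
  "('k::field \<Rightarrow> 'a::ab_group_add \<Rightarrow> 'a) \<Rightarrow> ('a \<Rightarrow> 'a \<Rightarrow> 'a) \<Rightarrow> bool"
  where "assoc_algebra sA \<mu> \<longleftrightarrow>
    bilin sA sA sA \<mu> \<and> (\<forall>a b c. \<mu> (\<mu> a b) c = \<mu> a (\<mu> b c))"

definition bimodule_over ::
  "('k::field \<Rightarrow> 'a::ab_group_add \<Rightarrow> 'a) \<Rightarrow> ('k \<Rightarrow> 'm::ab_group_add \<Rightarrow> 'm) \<Rightarrow>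
   ('a \<Rightarrow> 'a \<Rightarrow> 'a) \<Rightarrow> ('a \<Rightarrow> 'm \<Rightarrow> 'm) \<Rightarrow> ('m \<Rightarrow> 'a \<Rightarrow> 'm) \<Rightarrow> bool"
  where "bimodule_over sA sM \<mu> l r \<longleftrightarrow>
    bilin sA sM sM l \<and> bilin sM sA sM r \<and>
    (\<forall>a b u. l (\<mu> a b) u = l a (l b u)) \<and>
    (\<forall>a u b. r (l a u) b = l a (r u b)) \<and>
    (\<forall>u a b. r (r u a) b = r u (\<mu> a b))"

definition O_operator ::
  "('k::field \<Rightarrow> 'a::ab_group_add \<Rightarrow> 'a) \<Rightarrow> ('k \<Rightarrow> 'm::ab_group_add \<Rightarrow> 'm) \<Rightarrow>
   ('a \<Rightarrow> 'a \<Rightarrow> 'a) \<Rightarrow> ('a \<Rightarrow> 'm \<Rightarrow> 'm) \<Rightarrow> ('m \<Rightarrow> 'a \<Rightarrow> 'm) \<Rightarrow> ('m \<Rightarrow> 'a) \<Rightarrow> bool"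
  where "O_operator sA sM \<mu> l r T \<longleftrightarrow>
    Vector_Spaces.linear sM sA T \<and>
    (\<forall>u v. \<mu> (T u) (T v) = T (l (T u) v + r u (T v)))"

definition compatible_O_operator ::
  "('k::field \<Rightarrow> 'a::ab_group_add \<Rightarrow> 'a) \<Rightarrow> ('k \<Rightarrow> 'm::ab_group_add \<Rightarrow> 'm) \<Rightarrow>
   ('a \<Rightarrow> 'a \<Rightarrow> 'a) \<Rightarrow> ('a \<Rightarrow> 'm \<Rightarrow> 'm) \<Rightarrow> ('m \<Rightarrow> 'a \<Rightarrow> 'm) \<Rightarrow> ('m \<Rightarrow> 'a) \<times> ('m \<Rightarrow> 'a) \<Rightarrow> bool"
  where "compatible_O_operator sA sM \<mu> l r = (\<lambda>(T1, T2).
    O_operator sA sM \<mu> l r T1 \<and> O_operator sA sM \<mu> l r T2 \<and>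
    (\<forall>u v. \<mu> (T1 u) (T2 v) + \<mu> (T2 u) (T1 v) =
      T1 (l (T2 u) v + r u (T2 v)) + T2 (l (T1 u) v + r u (T1 v))))"

definition compatible_O_operator_algebra ::
  "('k::field \<Rightarrow> 'a::ab_group_add \<Rightarrow> 'a) \<Rightarrow> ('k \<Rightarrow> 'm::ab_group_add \<Rightarrow> 'm) \<Rightarrow>
   ('a \<Rightarrow> 'a \<Rightarrow> 'a) \<Rightarrow> ('a \<Rightarrow> 'm \<Rightarrow> 'm) \<Rightarrow> ('m \<Rightarrow> 'a \<Rightarrow> 'm) \<Rightarrow> ('m \<Rightarrow> 'a) \<times> ('m \<Rightarrow> 'a) \<Rightarrow> bool"
  where "compatible_O_operator_algebra sA sM \<mu> l r TT \<longleftrightarrow>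
    assoc_algebra sA \<mu> \<and> bimodule_over sA sM \<mu> l r \<and> compatible_O_operator sA sM \<mu> l r TT"


section \<open>Maurer-Cartan elements\<close>

text \<open>
  A graded vector space is a family \<open>L\<close> of subspaces of one ambient type, indexed by the degree.
  The operations \<open>l\<^sub>k\<close> are given on homogeneous elements, for all \<open>k\<close> at once: \<open>l\<close> takes the list of
  its \<open>k\<close> arguments, each one paired with its degree.  The Maurer-Cartan sum is required to have
  only finitely many nonzero terms; the equation has no meaning otherwise.
\<close>

definition maurer_cartan ::
  "('k::field_char_0 \<Rightarrow> 'v::ab_group_add \<Rightarrow> 'v) \<Rightarrow> (int \<Rightarrow> 'v set) \<Rightarrow> ((int \<times> 'v) list \<Rightarrow> 'v) \<Rightarrow>
   'v \<Rightarrow> bool"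
  where "maurer_cartan sL L l \<alpha> \<longleftrightarrow>
    \<alpha> \<in> L 0 \<and>
    finite {k. 1 \<le> k \<and> l (replicate k (0, \<alpha>)) \<noteq> 0} \<and>
    (\<Sum>k | 1 \<le> k \<and> l (replicate k (0, \<alpha>)) \<noteq> 0. sL (1 / fact k) (l (replicate k (0, \<alpha>)))) = 0"


section \<open>The graded spaces\<close>

text \<open>
  An element of \<open>V\<^sub>n\<close> is a multilinear function of \<open>n + 1\<close> arguments, encoded as a function on lists
  that is 0 on all lists of any other length.
\<close>

type_synonym ('a, 'm) cochain = "('a \<times> 'm) list \<Rightarrow> 'a \<times> 'm"

definition V ::
  "('k::field \<Rightarrow> 'a::ab_group_add \<Rightarrow> 'a) \<Rightarrow> ('k \<Rightarrow> 'm::ab_group_add \<Rightarrow> 'm) \<Rightarrow> nat \<Rightarrow>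
   ('a, 'm) cochain set"
  where "V sA sM n = {f.
    (\<forall>vs. length vs \<noteq> n + 1 \<longrightarrow> f vs = 0) \<and>
    (\<forall>vs i. length vs = n + 1 \<longrightarrow> i < n + 1 \<longrightarrow>
      Vector_Spaces.linear (module_prod.scale sA sM) (module_prod.scale sA sM)
        (\<lambda>x. f (vs[i := x])))}"

text \<open>
  The pure tensors spanning \<open>\<A>\<^sup>p\<^sup>,\<^sup>q\<close>: lists with \<open>p\<close> entries from \<open>A\<close> and \<open>q\<close> entries from \<open>M\<close>, in
  any order.
\<close>

definition pure_tensors :: "nat \<Rightarrow> nat \<Rightarrow> ('a::ab_group_add \<times> 'm::ab_group_add) list set"
  where "pure_tensors p q = {map (case_sum (\<lambda>a. (a, 0)) (\<lambda>u. (0, u))) ws | ws :: ('a + 'm) list.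
    length (filter isl ws) = p \<and> length (filter (\<lambda>w. \<not> isl w) ws) = q}"

definition V' ::
  "('k::field \<Rightarrow> 'a::ab_group_add \<Rightarrow> 'a) \<Rightarrow> ('k \<Rightarrow> 'm::ab_group_add \<Rightarrow> 'm) \<Rightarrow> nat \<Rightarrow>
   ('a, 'm) cochain set"
  where "V' sA sM n = {f \<in> V sA sM n.
    (\<forall>vs \<in> pure_tensors (n + 1) 0. snd (f vs) = 0) \<and>
    (\<forall>vs \<in> pure_tensors n 1. fst (f vs) = 0) \<and>
    (\<forall>p q. p + q = n + 1 \<longrightarrow> (p, q) \<noteq> (n + 1, 0) \<longrightarrow> (p, q) \<noteq> (n, 1) \<longrightarrow>
      (\<forall>vs \<in> pure_tensors p q. f vs = 0))}"

definition \<aa> ::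
  "('k::field \<Rightarrow> 'a::ab_group_add \<Rightarrow> 'a) \<Rightarrow> ('k \<Rightarrow> 'm::ab_group_add \<Rightarrow> 'm) \<Rightarrow> nat \<Rightarrow>
   ('a, 'm) cochain set"
  where "\<aa> sA sM n = {f \<in> V sA sM n.
    (\<forall>vs \<in> pure_tensors 0 (n + 1). snd (f vs) = 0) \<and>
    (\<forall>p q. p + q = n + 1 \<longrightarrow> (p, q) \<noteq> (0, n + 1) \<longrightarrow> (\<forall>vs \<in> pure_tensors p q. f vs = 0))}"

definition proj_\<aa> :: "('a::ab_group_add, 'm::ab_group_add) cochain \<Rightarrow> ('a, 'm) cochain"
  where "proj_\<aa> f = (\<lambda>vs. (fst (f (map (\<lambda>v. (0, snd v)) vs)), 0))"

text \<open>
  A tuple \<open>(\<theta>\<^sub>1, \<dots>, \<theta>\<^sub>i\<^sub>+\<^sub>2)\<close> in \<open>(\<aa>\<^sub>c)\<^sub>i\<close> is a function on indices that is 0 outside of \<open>{1..i + 2}\<close>.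
  For \<open>i = -1\<close> the only element is 0, as \<open>\<aa>\<^sub>-\<^sub>1 = 0\<close>.
\<close>

definition \<aa>c ::
  "('k::field \<Rightarrow> 'a::ab_group_add \<Rightarrow> 'a) \<Rightarrow> ('k \<Rightarrow> 'm::ab_group_add \<Rightarrow> 'm) \<Rightarrow> int \<Rightarrow>
   (nat \<Rightarrow> ('a, 'm) cochain) set"
  where "\<aa>c sA sM i = {\<theta>. \<forall>j.
    if 0 \<le> i \<and> 1 \<le> j \<and> int j \<le> i + 2 then \<theta> j \<in> \<aa> sA sM (nat i) else \<theta> j = 0}"

type_synonym ('a, 'm) total = "('a, 'm) cochain \<times> (nat \<Rightarrow> ('a, 'm) cochain)"

definition L_space ::
  "('k::field \<Rightarrow> 'a::ab_group_add \<Rightarrow> 'a) \<Rightarrow> ('k \<Rightarrow> 'm::ab_group_add \<Rightarrow> 'm) \<Rightarrow> int \<Rightarrow>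
   ('a, 'm) total set"
  where "L_space sA sM i =
    (if -1 \<le> i then V' sA sM (nat (i + 1)) \<times> \<aa>c sA sM i else {0})"

definition L_scale ::
  "('k::field \<Rightarrow> 'a::ab_group_add \<Rightarrow> 'a) \<Rightarrow> ('k \<Rightarrow> 'm::ab_group_add \<Rightarrow> 'm) \<Rightarrow>
   'k \<Rightarrow> ('a, 'm) total \<Rightarrow> ('a, 'm) total"
  where "L_scale sA sM c = (\<lambda>(f, \<theta>).
    (\<lambda>vs. module_prod.scale sA sM c (f vs), \<lambda>j vs. module_prod.scale sA sM c (\<theta> j vs)))"


section \<open>The Gerstenhaber bracket\<close>

definition ksign :: "'i::semiring_parity \<Rightarrow> 'v::ab_group_add \<Rightarrow> 'v"
  where "ksign e x = (if even e then x else - x)"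

text \<open>
  Arities cannot be read off from the functions, so the degrees \<open>m\<close> of \<open>f\<close> and \<open>n\<close> of \<open>g\<close> are passed
  explicitly.  As usual, the index \<open>i\<close> of an insertion starts at 1.
\<close>

definition insertion ::
  "nat \<Rightarrow> nat \<Rightarrow> nat \<Rightarrow> ('a::ab_group_add, 'm::ab_group_add) cochain \<Rightarrow> ('a, 'm) cochain \<Rightarrow>
   ('a, 'm) cochain"
  where "insertion m n i f g = (\<lambda>vs. if length vs = m + n + 1
    then f (take (i - 1) vs @ [g (take (n + 1) (drop (i - 1) vs))] @ drop (i + n) vs)
    else 0)"

definition gerst ::
  "nat \<Rightarrow> nat \<Rightarrow> ('a::ab_group_add, 'm::ab_group_add) cochain \<Rightarrow> ('a, 'm) cochain \<Rightarrow>
   ('a, 'm) cochain"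
  where "gerst m n f g =
    (\<Sum>i = 1..m + 1. ksign ((i - 1) * n) (insertion m n i f g)) -
    ksign (m * n) (\<Sum>i = 1..n + 1. ksign ((i - 1) * m) (insertion n m i g f))"

text \<open>The iterated bracket \<open>[\<dots>[[f, \<theta>\<^sub>1], \<theta>\<^sub>2], \<dots>]\<close>, each \<open>\<theta>\<^sub>s\<close> being paired with its degree.\<close>

fun gerst_iter ::
  "nat \<Rightarrow> ('a::ab_group_add, 'm::ab_group_add) cochain \<Rightarrow> (nat \<times> ('a, 'm) cochain) list \<Rightarrow>
   ('a, 'm) cochain"
  where
    "gerst_iter n f [] = f"
  | "gerst_iter n f ((i, \<theta>) # \<theta>s) = gerst_iter (n + i) (gerst n i f \<theta>) \<theta>s"


section \<open>The operations\<close>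

text \<open>
  \<open>derived_op n f [(i\<^sub>1, \<theta>\<^sup>1), \<dots>, (i\<^sub>n\<^sub>+\<^sub>1, \<theta>\<^sup>n\<^sup>+\<^sup>1)]\<close> is the value of the operation with \<open>n + 2\<close>
  arguments on \<open>f[1]\<close>, for \<open>f\<close> in \<open>V'\<^sub>n\<close>, and \<open>\<theta>\<^sup>s\<close> in \<open>(\<aa>\<^sub>c)\<close> of degree \<open>i\<^sub>s\<close>.  If some \<open>i\<^sub>s\<close> is -1,
  then \<open>\<theta>\<^sup>s = 0\<close> and so is the value; the use of \<^term>\<open>nat\<close> is immaterial then.
\<close>

definition derived_op ::
  "nat \<Rightarrow> ('a::ab_group_add, 'm::ab_group_add) cochain \<Rightarrow>
   (int \<times> (nat \<Rightarrow> ('a, 'm) cochain)) list \<Rightarrow> nat \<Rightarrow> ('a, 'm) cochain"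
  where "derived_op n f \<theta>s = (\<lambda>p.
    if 1 \<le> p \<and> int p \<le> int n + 2 + sum_list (map fst \<theta>s) then
      (\<Sum>js | length js = n + 1 \<and> sum_list js = p + n \<and>
             (\<forall>s < n + 1. 1 \<le> js ! s \<and> int (js ! s) \<le> fst (\<theta>s ! s) + 2).
        proj_\<aa> (gerst_iter n f (map2 (\<lambda>(i, \<theta>) j. (nat i, \<theta> j)) \<theta>s js)))
    else 0)"

text \<open>
  The operations on arbitrary homogeneous elements \<open>x\<^sub>s = (f\<^sub>s[1], \<theta>\<^sup>s)\<close> of degree \<open>i\<^sub>s\<close>, obtained by
  multilinear and graded symmetric extension.  Expanding \<open>l\<^sub>k(x\<^sub>1, \<dots>, x\<^sub>k)\<close> leaves only two
  kinds of terms.  Those with values in \<open>V'[1]\<close> have \<open>k = 2\<close> and both arguments from \<open>V'[1]\<close>; note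
  that \<open>f\<^sub>1\<close> lies in \<open>V'\<^sub>m\<close> for \<open>m = i\<^sub>1 + 1\<close>.  Those with values in \<open>\<aa>\<^sub>c\<close> have exactly one argument
  \<open>f\<^sub>s[1]\<close> from \<open>V'[1]\<close>, where \<open>f\<^sub>s\<close> has degree \<open>k - 2\<close>, i.e. \<open>i\<^sub>s = k - 3\<close>; moving it to the front
  past \<open>\<theta>\<^sup>1, \<dots>, \<theta>\<^sup>s\<^sup>-\<^sup>1\<close> produces the Koszul sign.
\<close>

definition ltilde ::
  "(int \<times> ('a::ab_group_add, 'm::ab_group_add) total) list \<Rightarrow> ('a, 'm) total"
  where "ltilde xs =
    ((case xs of
        [(i1, (f1, _)), (i2, (f2, _))] \<Rightarrow>
          ksign (i1 + 1) (gerst (nat (i1 + 1)) (nat (i2 + 1)) f1 f2)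
      | _ \<Rightarrow> 0),
     (if 2 \<le> length xs then
        (\<Sum>s | s < length xs \<and> fst (xs ! s) = int (length xs) - 3.
          ksign (fst (xs ! s) * sum_list (map fst (take s xs)))
            (derived_op (length xs - 2) (fst (snd (xs ! s)))
              (map (\<lambda>(i, (f, \<theta>)). (i, \<theta>)) (take s xs @ drop (Suc s) xs))))
      else 0))"


section \<open>The element associated with the structure maps\<close>

text \<open>The structure maps, extended by 0 to all of \<open>A \<oplus> M\<close>.\<close>

definition ext_\<mu> :: "('a::ab_group_add \<Rightarrow> 'a \<Rightarrow> 'a) \<Rightarrow> ('a, 'm::ab_group_add) cochain"
  where "ext_\<mu> \<mu> = (\<lambda>vs. case vs of [x, y] \<Rightarrow> (\<mu> (fst x) (fst y), 0) | _ \<Rightarrow> 0)"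

definition ext_l :: "('a::ab_group_add \<Rightarrow> 'm::ab_group_add \<Rightarrow> 'm) \<Rightarrow> ('a, 'm) cochain"
  where "ext_l l = (\<lambda>vs. case vs of [x, y] \<Rightarrow> (0, l (fst x) (snd y)) | _ \<Rightarrow> 0)"

definition ext_r :: "('m::ab_group_add \<Rightarrow> 'a::ab_group_add \<Rightarrow> 'm) \<Rightarrow> ('a, 'm) cochain"
  where "ext_r r = (\<lambda>vs. case vs of [x, y] \<Rightarrow> (0, r (snd x) (fst y)) | _ \<Rightarrow> 0)"

definition ext_T :: "('m::ab_group_add \<Rightarrow> 'a::ab_group_add) \<Rightarrow> ('a, 'm) cochain"
  where "ext_T T = (\<lambda>vs. case vs of [x] \<Rightarrow> (T (snd x), 0) | _ \<Rightarrow> 0)"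

definition pair_tuple :: "('a, 'm) cochain \<Rightarrow> ('a, 'm) cochain \<Rightarrow>
    nat \<Rightarrow> ('a::ab_group_add, 'm::ab_group_add) cochain"
  where "pair_tuple \<theta>1 \<theta>2 = (\<lambda>j. if j = 1 then \<theta>1 else if j = 2 then \<theta>2 else 0)"

end

theory Submission
  imports Defs
begin

text \<open>
  Write \<open>\<pi> = \<mu> + l + r\<close> and \<open>\<theta> = (T\<^sub>1, T\<^sub>2)\<close>.  All arguments of the operations have degree 0, so
  every Koszul sign is trivial, and for degree reasons only the operations with two and three
  arguments contribute to the Maurer-Cartan sum of \<open>(\<pi>[1], \<theta>)\<close>.  The first is \<open>- [\<pi>, \<pi>]\<close>, because
  \<open>\<pi>\<close> has odd degree.  The second is three times \<open>D\<close>, where \<open>D\<close> is the value on \<open>\<pi>[1], \<theta>, \<theta>\<close>: the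
  argument from \<open>V'[1]\<close> can be taken from any of the three places.  The sum is therefore
  \<open>1/2 (- [\<pi>, \<pi>], D)\<close>, and in characteristic 0 it vanishes exactly if \<open>[\<pi>, \<pi>] = 0\<close> and \<open>D = 0\<close>
  (lemma \<open>maurer_cartan_degree_0_iff\<close>).  That the pair lies in the space of degree 0 at all is the
  multilinearity of the structure maps (lemma \<open>in_L_space_0\<close>).

  The cochain \<open>\<pi>\<close> is the multiplication of the semidirect product \<open>A \<oplus> M\<close>, and \<open>[\<pi>, \<pi>]\<close> is twice its
  associator.  Its components are the associator of \<open>\<mu>\<close> and the sum of the defects of the three
  bimodule laws, and the three defects can be separated by inserting zeros (lemma
  \<open>structure_cochain_assoc_iff\<close>).

  On two arguments from \<open>M\<close>, the \<open>A\<close>-component of \<open>[[\<pi>, T], S]\<close> is the polarization of the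
  \<open>O\<close>-operator identity, a quadratic expression in \<open>T\<close> (lemma \<open>proj_double_bracket\<close>).  The index
  condition \<open>j\<^sub>1 + j\<^sub>2 = p + 1\<close> collects these brackets in the three entries of \<open>D\<close>: twice the
  identity for \<open>T\<^sub>1\<close>, twice the compatibility condition and twice the identity for \<open>T\<^sub>2\<close>.
\<close>

section \<open>Pure tensors of small length\<close>

lemma pure_tensors_1:
  assumes "vs \<in> pure_tensors p q" and "p + q = 1"
  obtains a where "vs = [(a, 0)]" "p = 1" "q = 0"
  | u where "vs = [(0, u)]" "p = 0" "q = 1"
proof -
  from assms(1) obtain ws :: "('a + 'b) list"
    where ws: "vs = map (case_sum (\<lambda>a. (a, 0)) (\<lambda>u. (0, u))) ws"
      "length (filter isl ws) = p" "length (filter (\<lambda>w. \<not> isl w) ws) = q"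
    unfolding pure_tensors_def by auto
  have "length ws = Suc 0"
    using sum_length_filter_compl[of isl ws] ws assms(2) by simp
  then obtain w where "ws = [w]"
    by (auto simp: length_Suc_conv)
  with ws that show thesis
    by (cases w) auto
qed

lemma pure_tensors_2:
  assumes "vs \<in> pure_tensors p q" and "p + q = 2"
  obtains a b where "vs = [(a, 0), (b, 0)]" "p = 2" "q = 0"
  | a v where "vs = [(a, 0), (0, v)]" "p = 1" "q = 1"
  | u b where "vs = [(0, u), (b, 0)]" "p = 1" "q = 1"
  | u v where "vs = [(0, u), (0, v)]" "p = 0" "q = 2"
proof -
  from assms(1) obtain ws :: "('a + 'b) list"
    where ws: "vs = map (case_sum (\<lambda>a. (a, 0)) (\<lambda>u. (0, u))) ws"
      "length (filter isl ws) = p" "length (filter (\<lambda>w. \<not> isl w) ws) = q"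
    unfolding pure_tensors_def by auto
  have "length ws = Suc (Suc 0)"
    using sum_length_filter_compl[of isl ws] ws assms(2) by simp
  then obtain w w' where "ws = [w, w']"
    by (auto simp: length_Suc_conv)
  then have vs: "vs = map (case_sum (\<lambda>a. (a, 0)) (\<lambda>u. (0, u))) [w, w']"
    and p: "p = length (filter isl [w, w'])" and q: "q = length (filter (\<lambda>w. \<not> isl w) [w, w'])"
    using ws by simp_all
  show thesis
  proof (cases w; cases w')
    fix a b assume "w = Inl a" "w' = Inl b"
    then show thesis using vs p q by (intro that(1)[of a b]) simp_all
  next
    fix a v assume "w = Inl a" "w' = Inr v"
    then show thesis using vs p q by (intro that(2)[of a v]) simp_all
  next
    fix u b assume "w = Inr u" "w' = Inl b"
    then show thesis using vs p q by (intro that(3)[of u b]) simp_all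
  next
    fix u v assume "w = Inr u" "w' = Inr v"
    then show thesis using vs p q by (intro that(4)[of u v]) simp_all
  qed
qed


text \<open>
  For the two spaces that occur below, the conditions on all pure tensors come down to finitely many
  shapes of arguments.
\<close>

lemma V'_1I:
  assumes "f \<in> V sA sM 1"
    and "\<And>a b. snd (f [(a, 0), (b, 0)]) = 0"
    and "\<And>a v. fst (f [(a, 0), (0, v)]) = 0"
    and "\<And>u b. fst (f [(0, u), (b, 0)]) = 0"
    and "\<And>u v. f [(0, u), (0, v)] = 0"
  shows "f \<in> V' sA sM 1"
proof -
  have on_pure: "(p = 2 \<and> q = 0 \<longrightarrow> snd (f vs) = 0) \<and> (p = 1 \<and> q = 1 \<longrightarrow> fst (f vs) = 0)
      \<and> (p = 0 \<and> q = 2 \<longrightarrow> f vs = 0)"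
    if "vs \<in> pure_tensors p q" and "p + q = 2" for vs p q
    using that by (rule pure_tensors_2) (simp_all add: assms(2-5))
  have other: "f vs = 0"
    if "p + q = 2" "(p, q) \<noteq> (2, 0)" "(p, q) \<noteq> (1, 1)" "vs \<in> pure_tensors p q" for p q vs
  proof -
    have "p = 0 \<and> q = 2"
      using that(1-3) unfolding prod.inject by presburger
    then show ?thesis
      using on_pure[OF that(4,1)] by blast
  qed
  have AA: "snd (f vs) = 0" if "vs \<in> pure_tensors 2 0" for vs
    using on_pure[OF that add_0_right] by blast
  have AM: "fst (f vs) = 0" if "vs \<in> pure_tensors 1 1" for vs
    using on_pure[OF that one_add_one] by blast
  show ?thesis
    unfolding V'_def one_add_one
    by (intro CollectI conjI ballI allI impI) (rule assms(1), erule AA, erule AM, rule other)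
qed

lemma \<aa>_0I:
  assumes "f \<in> V sA sM 0"
    and "\<And>u. snd (f [(0, u)]) = 0"
    and "\<And>a. f [(a, 0)] = 0"
  shows "f \<in> \<aa> sA sM 0"
proof -
  have on_pure: "(p = 0 \<and> q = 1 \<longrightarrow> snd (f vs) = 0) \<and> (p = 1 \<and> q = 0 \<longrightarrow> f vs = 0)"
    if "vs \<in> pure_tensors p q" and "p + q = 1" for vs p q
    using that by (rule pure_tensors_1) (simp_all add: assms(2,3))
  have other: "f vs = 0"
    if "p + q = 1" "(p, q) \<noteq> (0, 1)" "vs \<in> pure_tensors p q" for p q vs
  proof -
    have "p = 1 \<and> q = 0"
      using that(1,2) unfolding prod.inject by presburger
    then show ?thesis
      using on_pure[OF that(3,1)] by blast
  qed
  have M: "snd (f vs) = 0" if "vs \<in> pure_tensors 0 1" for vs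
    using on_pure[OF that add_0] by blast
  show ?thesis
    unfolding \<aa>_def add_0
    by (intro CollectI conjI ballI allI impI) (rule assms(1), erule M, rule other)
qed

section \<open>Low-degree Gerstenhaber brackets\<close>

text \<open>
  In odd degree the two halves of the bracket of \<open>f\<close> with itself agree instead of cancelling, and
  the bracket is twice the associator.
\<close>

lemma gerst_1_1_self:
  "gerst 1 1 f f [x, y, z] =
    (f [f [x, y], z] - f [x, f [y, z]]) + (f [f [x, y], z] - f [x, f [y, z]])"
  by (simp add: gerst_def insertion_def ksign_def)

lemma gerst_1_1_self_other:
  "length vs \<noteq> 3 \<Longrightarrow> gerst 1 1 f f vs = 0"
  by (simp add: gerst_def insertion_def ksign_def)

lemma gerst_1_0:
  "gerst (Suc 0) 0 f \<theta> [x, y] = f [\<theta> [x], y] + f [x, \<theta> [y]] - \<theta> [f [x, y]]"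
  by (simp add: gerst_def insertion_def ksign_def)

lemma gerst_1_0_other:
  "length vs \<noteq> 2 \<Longrightarrow> gerst (Suc 0) 0 f \<theta> vs = 0"
  by (simp add: gerst_def insertion_def ksign_def)


section \<open>The Maurer-Cartan sum in degree 0\<close>

text \<open>
  With all degrees 0, the term with \<open>k\<close> arguments and values in \<open>\<aa>\<^sub>c\<close> needs \<open>k - 3 = 0\<close>; it has one
  summand for each place from which the argument in \<open>V'[1]\<close> is taken.
\<close>

lemma ltilde_degree_0:
  "ltilde (replicate k (0, (f, \<theta>))) =
    (if k = 2 then (- gerst 1 1 f f, 0)
     else if k = 3 then (0, derived_op 1 f [(0, \<theta>), (0, \<theta>)]
       + derived_op 1 f [(0, \<theta>), (0, \<theta>)] + derived_op 1 f [(0, \<theta>), (0, \<theta>)])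
     else 0)"
proof -
  consider "k = 0" | "k = 1" | "k = 2" | "k = 3" | j where "k = Suc (Suc (Suc (Suc j)))"
    by (metis One_nat_def Suc_1 nat.exhaust numeral_3_eq_3)
  then show ?thesis
  proof cases
    case 3
    have "{s. s < Suc (Suc 0) \<and> fst ([(0::int, (f, \<theta>)), (0, (f, \<theta>))] ! s) = - 1} = {}"
      by (auto simp: less_Suc_eq nth_Cons')
    with 3 show ?thesis
      by (auto simp: ltilde_def ksign_def numeral_2_eq_2 intro!: sum.neutral)
  next
    case 4
    have "{s. s < Suc (Suc (Suc 0)) \<and>
        fst ([(0::int, (f, \<theta>)), (0, (f, \<theta>)), (0, (f, \<theta>))] ! s) = 0} = {0, 1, 2}"
      by (auto simp: less_Suc_eq)
    with 4 show ?thesis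
      by (simp add: ltilde_def ksign_def numeral_3_eq_3 numeral_2_eq_2 add.assoc)
  next
    case 5
    then have "{s. s < length (replicate k (0::int, (f, \<theta>)))
        \<and> fst (replicate k (0::int, (f, \<theta>)) ! s)
          = int (length (replicate k (0::int, (f, \<theta>)))) - 3} = {}"
      by (auto simp del: replicate_Suc)
    then show ?thesis
      unfolding ltilde_def by (simp only: sum.empty) (simp add: 5 zero_prod_def)
  qed (simp_all add: ltilde_def zero_prod_def)
qed

lemma index_pairs:
  "{js. length js = 1 + 1 \<and> sum_list js = p + 1 \<and>
      (\<forall>s < 1 + 1. 1 \<le> js ! s \<and> int (js ! s) \<le> fst ([(0, \<theta>), (0, \<theta>)] ! s) + 2)} =
    (if p = 1 then {[1, 1]} else if p = 2 then {[1, 2], [2, 1]}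
     else if p = 3 then {[2, 2]} else {})" (is "?S = ?R")
proof (rule set_eqI)
  fix js :: "nat list"
  show "js \<in> ?S \<longleftrightarrow> js \<in> ?R"
  proof (cases "length js = 2")
    case True
    then obtain i j where js: "js = [i, j]"
      by (auto simp: numeral_2_eq_2 length_Suc_conv)
    have "js \<in> ?S \<longleftrightarrow> i + j = p + 1 \<and> i \<in> {1, 2} \<and> j \<in> {1, 2}"
      by (auto simp: js All_less_Suc)
    also have "\<dots> \<longleftrightarrow> js \<in> ?R"
      by (auto simp: js)
    finally show ?thesis .
  qed auto
qed

lemma derived_op_degree_0:
  fixes f :: "('a::ab_group_add, 'm::ab_group_add) cochain"
  defines "B \<equiv> \<lambda>\<theta> \<theta>'. proj_\<aa> (gerst 1 0 (gerst 1 0 f \<theta>) \<theta>')"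
  shows "derived_op 1 f [(0, \<theta>), (0, \<theta>)] p =
    (if p = 1 then B (\<theta> 1) (\<theta> 1) else if p = 2 then B (\<theta> 1) (\<theta> 2) + B (\<theta> 2) (\<theta> 1)
     else if p = 3 then B (\<theta> 2) (\<theta> 2) else 0)"
  unfolding derived_op_def index_pairs by (auto simp: B_def)

text \<open>
  The brackets below all come out as doubled expressions, and this removes the factor 2.
\<close>

lemma double_eq_0_iff:
  fixes s :: "'k::field_char_0 \<Rightarrow> 'v::ab_group_add \<Rightarrow> 'v" and x :: 'v
  assumes "vector_space s"
  shows "x + x = 0 \<longleftrightarrow> x = 0"
proof -
  interpret vector_space s by fact
  have "x + x = s 2 x"
    using scale_left_distrib[of 1 1 x] by simp
  then show ?thesis by simp
qed

lemma vector_space_L_scale: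
  assumes "vector_space sA" and "vector_space sM"
  shows "vector_space (L_scale sA sM)"
proof -
  interpret vector_space_prod sA sM
    using assms by (simp add: vector_space_prod_def vector_space_pair_def)
  show ?thesis
    by unfold_locales
      (auto simp: L_scale_def fun_eq_iff p.scale_right_distrib p.scale_left_distrib)
qed

text \<open>The coefficient of the second component is \<open>1/3!\<close> times the three equal summands, again \<open>1/2\<close>.\<close>

lemma maurer_cartan_degree_0_iff:
  assumes "vector_space sA" and "vector_space (sM :: 'k::field_char_0 \<Rightarrow> _)"
  shows "maurer_cartan (L_scale sA sM) (L_space sA sM) ltilde (f, \<theta>) \<longleftrightarrow>
    (f, \<theta>) \<in> L_space sA sM 0 \<and> gerst 1 1 f f = 0 \<and> derived_op 1 f [(0, \<theta>), (0, \<theta>)] = 0"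
proof -
  interpret vector_space "L_scale sA sM"
    using assms by (rule vector_space_L_scale)
  define G D where "G = gerst 1 1 f f" and "D = derived_op 1 f [(0, \<theta>), (0, \<theta>)]"
  let ?l = "\<lambda>k. ltilde (replicate k (0::int, (f, \<theta>)))"
  let ?S = "{k. 1 \<le> k \<and> ?l k \<noteq> 0}"
  have sub: "?S \<subseteq> {2, 3}"
    by (auto simp: ltilde_degree_0 split: if_splits)
  then have fin: "finite ?S"
    by (rule finite_subset) simp
  have "(\<Sum>k\<in>?S. L_scale sA sM (1 / fact k) (?l k)) =
      (\<Sum>k\<in>{2, 3}. L_scale sA sM (1 / fact k) (?l k))"
    using sub by (intro sum.mono_neutral_left) auto
  also have "\<dots> = L_scale sA sM (1 / 2) (- G, 0) + L_scale sA sM (1 / 6) (0, D + D + D)"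
    by (simp add: ltilde_degree_0 G_def D_def fact_numeral)
  also have "(0, D + D + D) = L_scale sA sM 3 (0, D)"
  proof -
    have "L_scale sA sM (1 + 1 + 1) (0, D) = (0, D) + (0, D) + (0, D)"
      by (simp only: scale_left_distrib scale_one)
    then show ?thesis by simp
  qed
  also have "L_scale sA sM (1 / 2) (- G, 0) + L_scale sA sM (1 / 6) (L_scale sA sM 3 (0, D)) =
      L_scale sA sM (1 / 2) (- G, D)"
    by (simp add: scale_right_distrib[symmetric])
  finally have "(\<Sum>k\<in>?S. L_scale sA sM (1 / fact k) (?l k)) = 0 \<longleftrightarrow> (- G, D) = 0"
    by (simp only: scale_eq_0_iff) simp
  also have "\<dots> \<longleftrightarrow> G = 0 \<and> D = 0"
    by (simp add: zero_prod_def)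
  finally have "(\<Sum>k\<in>?S. L_scale sA sM (1 / fact k) (?l k)) = 0 \<longleftrightarrow> G = 0 \<and> D = 0" .
  with fin show ?thesis
    by (auto simp: maurer_cartan_def G_def D_def)
qed


section \<open>The structure maps and their cochains\<close>

lemma bilin_simps:
  assumes "bilin s1 s2 s3 f"
  shows "f (x + x') y = f x y + f x' y" "f x (y + y') = f x y + f x y'"
    "f (s1 c x) y = s3 c (f x y)" "f x (s2 c y) = s3 c (f x y)"
    "f 0 y = 0" "f x 0 = 0"
proof -
  have right: "module_hom s2 s3 (f x)" for x
    using assms unfolding bilin_def linear_iff_module_hom by blast
  have left: "module_hom s1 s3 (\<lambda>x. f x y)" for y
    using assms unfolding bilin_def linear_iff_module_hom by blast
  show "f (x + x') y = f x y + f x' y" "f (s1 c x) y = s3 c (f x y)" "f 0 y = 0"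
    by (rule module_hom.add[OF left] module_hom.scale[OF left] module_hom.zero[OF left])+
  show "f x (y + y') = f x y + f x y'" "f x (s2 c y) = s3 c (f x y)" "f x 0 = 0"
    by (rule module_hom.add[OF right] module_hom.scale[OF right] module_hom.zero[OF right])+
qed

locale bilinear_structure_maps =
  fixes sA :: "'k::field_char_0 \<Rightarrow> 'a::ab_group_add \<Rightarrow> 'a"
    and sM :: "'k \<Rightarrow> 'm::ab_group_add \<Rightarrow> 'm"
    and \<mu> :: "'a \<Rightarrow> 'a \<Rightarrow> 'a"
    and l :: "'a \<Rightarrow> 'm \<Rightarrow> 'm"
    and r :: "'m \<Rightarrow> 'a \<Rightarrow> 'm"
  assumes vs_A: "vector_space sA"
    and vs_M: "vector_space sM"
    and bilin_\<mu>: "bilin sA sA sA \<mu>"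
    and bilin_l: "bilin sA sM sM l"
    and bilin_r: "bilin sM sA sM r"
begin

sublocale vector_space_prod sA sM
  using vs_A vs_M by (simp add: vector_space_prod_def vector_space_pair_def)

lemmas \<mu>_simps = bilin_simps[OF bilin_\<mu>]
  and l_simps = bilin_simps[OF bilin_l]
  and r_simps = bilin_simps[OF bilin_r]

text \<open>By the next lemma, this is the multiplication of the semidirect product \<open>A \<oplus> M\<close>.\<close>

definition structure_cochain :: "('a, 'm) cochain"
  where "structure_cochain = ext_\<mu> \<mu> + ext_l l + ext_r r"

lemma structure_cochain_pair:
  "structure_cochain [x, y] = (\<mu> (fst x) (fst y), l (fst x) (snd y) + r (snd x) (fst y))"
  by (simp add: structure_cochain_def ext_\<mu>_def ext_l_def ext_r_def)

lemma structure_cochain_other: "length vs \<noteq> 2 \<Longrightarrow> structure_cochain vs = 0"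
  by (auto simp: structure_cochain_def ext_\<mu>_def ext_l_def ext_r_def split: list.split)

lemma structure_cochain_in_V': "structure_cochain \<in> V' sA sM 1"
proof (rule V'_1I)
  show "structure_cochain \<in> V sA sM 1"
    unfolding V_def
  proof (intro CollectI conjI allI impI)
    fix vs :: "('a \<times> 'm) list" and i :: nat
    assume "length vs = 1 + 1" and i: "i < 1 + 1"
    then obtain x y where vs: "vs = [x, y]"
      by (auto simp: length_Suc_conv)
    show "Vector_Spaces.linear scale scale (\<lambda>x. structure_cochain (vs[i := x]))"
    proof (cases "i = 0")
      case True
      then show ?thesis
        by (simp add: Vector_Spaces.linear_iff p.vector_space_axioms vs structure_cochain_pair
            scale_def \<mu>_simps l_simps r_simps vs2.scale_right_distrib add_ac)
    next
      case False
      with i have "i = 1" by simp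
      then show ?thesis
        by (simp add: Vector_Spaces.linear_iff p.vector_space_axioms vs structure_cochain_pair
            scale_def \<mu>_simps l_simps r_simps vs2.scale_right_distrib add_ac)
    qed
  qed (simp add: structure_cochain_other)
qed (simp_all only: structure_cochain_pair fst_conv snd_conv \<mu>_simps(5,6) l_simps(5,6) r_simps(5,6)
    add_0 zero_prod_def)

lemma ext_T_in_\<aa>:
  assumes "Vector_Spaces.linear sM sA T"
  shows "ext_T T \<in> \<aa> sA sM 0"
proof -
  interpret T: Vector_Spaces.linear sM sA T by fact
  have single: "ext_T T [x] = (T (snd x), 0)" for x :: "'a \<times> 'm"
    by (simp add: ext_T_def)
  show ?thesis
  proof (rule \<aa>_0I)
    show "ext_T T \<in> V sA sM 0"
      unfolding V_def
    proof (intro CollectI conjI allI impI)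
      fix vs :: "('a \<times> 'm) list" and i :: nat
      assume "length vs = 0 + 1" and i: "i < 0 + 1"
      then obtain x where vs: "vs = [x]"
        by (auto simp: length_Suc_conv)
      show "Vector_Spaces.linear scale scale (\<lambda>x. ext_T T (vs[i := x]))"
        using i by (simp add: Vector_Spaces.linear_iff p.vector_space_axioms vs single scale_def
            T.add T.scale)
    qed (auto simp: ext_T_def split: list.split)
  qed (simp_all only: single fst_conv snd_conv T.zero zero_prod_def)
qed

lemma in_L_space_0:
  assumes "Vector_Spaces.linear sM sA T1" and "Vector_Spaces.linear sM sA T2"
  shows "(structure_cochain, pair_tuple (ext_T T1) (ext_T T2)) \<in> L_space sA sM 0"
proof -
  have "pair_tuple (ext_T T1) (ext_T T2) j \<in> \<aa> sA sM 0" if "1 \<le> j \<and> int j \<le> 0 + 2" for j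
  proof -
    from that have "j = 1 \<or> j = 2" by auto
    then show ?thesis
      using ext_T_in_\<aa>[OF assms(1)] ext_T_in_\<aa>[OF assms(2)] by (auto simp: pair_tuple_def)
  qed
  moreover have "pair_tuple (ext_T T1) (ext_T T2) j = 0" if "\<not> (1 \<le> j \<and> int j \<le> 0 + 2)" for j
    using that by (auto simp: pair_tuple_def)
  ultimately have "pair_tuple (ext_T T1) (ext_T T2) \<in> \<aa>c sA sM 0"
    by (simp add: \<aa>c_def)
  with structure_cochain_in_V' show ?thesis
    by (simp add: L_space_def)
qed

text \<open>
  The \<open>M\<close>-component of the associator is a sum of three expressions, each of which depends on only one
  of the \<open>M\<close>-components of the arguments.  Setting the other two to 0 isolates one bimodule law.
\<close>

lemma structure_cochain_assoc_iff:
  "(\<forall>x y z. structure_cochain [structure_cochain [x, y], z] =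
      structure_cochain [x, structure_cochain [y, z]]) \<longleftrightarrow>
    assoc_algebra sA \<mu> \<and> bimodule_over sA sM \<mu> l r" (is "?assoc \<longleftrightarrow> ?alg")
proof
  assume assoc: ?assoc
  have comps: "\<mu> (\<mu> a b) c = \<mu> a (\<mu> b c) \<and>
      l (\<mu> a b) w + r (l a v + r u b) c = l a (l b w + r v c) + r u (\<mu> b c)" for a b c u v w
    using assoc[rule_format, of "(a, u)" "(b, v)" "(c, w)"]
    by (simp add: structure_cochain_pair)
  have "l (\<mu> a b) w = l a (l b w)" for a b w
    using comps[of a b 0 w 0 0] by (simp add: \<mu>_simps l_simps r_simps)
  moreover have "r (l a v) c = l a (r v c)" for a v c
    using comps[of a 0 c 0 v 0] by (simp add: \<mu>_simps l_simps r_simps)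
  moreover have "r (r u b) c = r u (\<mu> b c)" for u b c
    using comps[of 0 b c 0 0 u] by (simp add: \<mu>_simps l_simps r_simps)
  ultimately show ?alg
    using bilin_\<mu> bilin_l bilin_r comps
    by (simp add: assoc_algebra_def bimodule_over_def)
next
  assume ?alg
  then show ?assoc
    by (simp add: structure_cochain_pair assoc_algebra_def bimodule_over_def l_simps r_simps
        add.assoc)
qed

lemma gerst_structure_cochain_eq_0_iff:
  "gerst 1 1 structure_cochain structure_cochain = 0 \<longleftrightarrow>
    assoc_algebra sA \<mu> \<and> bimodule_over sA sM \<mu> l r"
proof -
  have "gerst 1 1 structure_cochain structure_cochain = 0 \<longleftrightarrow>
    (\<forall>x y z. structure_cochain [structure_cochain [x, y], z] =
      structure_cochain [x, structure_cochain [y, z]])" (is "_ \<longleftrightarrow> ?assoc")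
  proof
    assume *: "gerst 1 1 structure_cochain structure_cochain = 0"
    show ?assoc
    proof (intro allI)
      fix x y z
      show "structure_cochain [structure_cochain [x, y], z] =
          structure_cochain [x, structure_cochain [y, z]]"
        using fun_cong[OF *, of "[x, y, z]"]
        by (simp add: gerst_1_1_self double_eq_0_iff[OF p.vector_space_axioms]
            del: One_nat_def)
    qed
  next
    assume *: ?assoc
    have "gerst 1 1 structure_cochain structure_cochain [x, y, z] = 0" for x y z
      by (simp only: gerst_1_1_self *[rule_format]) simp
    moreover have "\<exists>x y z. vs = [x, y, z]" if "length vs = 3" for vs :: "('a \<times> 'm) list"
      using that by (auto simp: numeral_3_eq_3 length_Suc_conv)
    ultimately have "gerst 1 1 structure_cochain structure_cochain vs = 0" for vs
      using gerst_1_1_self_other by blast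
    then show "gerst 1 1 structure_cochain structure_cochain = 0"
      by (intro ext) simp
  qed
  then show ?thesis
    by (simp only: structure_cochain_assoc_iff)
qed

text \<open>
  The polarization of the defect of the \<open>O\<close>-operator identity: on the diagonal it is twice the
  defect for \<open>T\<close>, off the diagonal it is the defect of the compatibility condition.
\<close>

definition O_defect :: "('m \<Rightarrow> 'a) \<Rightarrow> ('m \<Rightarrow> 'a) \<Rightarrow> 'm \<Rightarrow> 'm \<Rightarrow> 'a"
  where "O_defect T S u v = \<mu> (T u) (S v) + \<mu> (S u) (T v)
    - T (l (S u) v + r u (S v)) - S (l (T u) v + r u (T v))"

lemma O_defect_commute: "O_defect T S = O_defect S T"
  by (simp add: O_defect_def fun_eq_iff algebra_simps)

text \<open>
  Since \<open>T\<close> and \<open>S\<close> vanish on \<open>A\<close> and \<open>\<pi>\<close> vanishes on \<open>M \<otimes> M\<close>, what remains of the double bracket on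
  \<open>M \<otimes> M\<close> is \<open>T\<close> and \<open>S\<close> inserted into both arguments of \<open>\<mu>\<close>, and each of them applied to a
  product with the other.
\<close>

lemma proj_double_bracket:
  assumes "Vector_Spaces.linear sM sA T" and "Vector_Spaces.linear sM sA S"
  shows "proj_\<aa> (gerst 1 0 (gerst 1 0 structure_cochain (ext_T T)) (ext_T S)) vs =
    (case vs of [x, y] \<Rightarrow> (O_defect T S (snd x) (snd y), 0) | _ \<Rightarrow> 0)"
proof (cases "length vs = 2")
  case True
  interpret T: Vector_Spaces.linear sM sA T by fact
  interpret S: Vector_Spaces.linear sM sA S by fact
  from True obtain x y where "vs = [x, y]"
    by (auto simp: numeral_2_eq_2 length_Suc_conv)
  then show ?thesis
    by (simp add: proj_\<aa>_def gerst_1_0 structure_cochain_pair O_defect_def ext_T_def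
        T.zero S.zero T.add S.add \<mu>_simps l_simps r_simps algebra_simps)
next
  case False
  then show ?thesis
    by (auto simp: proj_\<aa>_def gerst_1_0_other zero_prod_def split: list.split)
qed

text \<open>
  The middle entry contains the two mixed brackets; they agree by the symmetry of \<^const>\<open>O_defect\<close>, so
  it carries the same factor 2 as the outer ones.
\<close>

lemma derived_op_structure_cochain_eq_0_iff:
  assumes T1: "Vector_Spaces.linear sM sA T1" and T2: "Vector_Spaces.linear sM sA T2"
  defines "\<theta> \<equiv> pair_tuple (ext_T T1) (ext_T T2)"
  shows "derived_op 1 structure_cochain [(0, \<theta>), (0, \<theta>)] = 0 \<longleftrightarrow>
    compatible_O_operator sA sM \<mu> l r (T1, T2)"
proof -
  let ?B = "\<lambda>T S. proj_\<aa> (gerst 1 0 (gerst 1 0 structure_cochain (ext_T T)) (ext_T S))"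
  note half = double_eq_0_iff[OF vs_A]
  have B_eq_0: "?B T S = 0 \<longleftrightarrow> (\<forall>u v. O_defect T S u v = 0)"
    if "Vector_Spaces.linear sM sA T" "Vector_Spaces.linear sM sA S" for T S
  proof
    assume *: "?B T S = 0"
    show "\<forall>u v. O_defect T S u v = 0"
    proof (intro allI)
      fix u v
      show "O_defect T S u v = 0"
        using fun_cong[OF *, of "[(0, u), (0, v)]"]
        by (simp add: proj_double_bracket[OF that] zero_prod_def
            del: One_nat_def)
    qed
  qed (auto simp: fun_eq_iff proj_double_bracket[OF that] zero_prod_def
      simp del: One_nat_def split: list.split)
  have B_sym: "?B T2 T1 = ?B T1 T2"
    by (intro ext)
      (simp only: proj_double_bracket[OF T1 T2] proj_double_bracket[OF T2 T1]
        O_defect_commute[of T2 T1])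
  have self: "O_defect T T u v = 0 \<longleftrightarrow> \<mu> (T u) (T v) = T (l (T u) v + r u (T v))" for T u v
  proof -
    have "O_defect T T u v = (\<mu> (T u) (T v) - T (l (T u) v + r u (T v)))
        + (\<mu> (T u) (T v) - T (l (T u) v + r u (T v)))"
      by (simp add: O_defect_def algebra_simps)
    then show ?thesis by (simp add: half)
  qed
  have mixed: "O_defect T1 T2 u v = 0 \<longleftrightarrow> \<mu> (T1 u) (T2 v) + \<mu> (T2 u) (T1 v) =
      T1 (l (T2 u) v + r u (T2 v)) + T2 (l (T1 u) v + r u (T1 v))" for u v
    by (simp add: O_defect_def diff_diff_eq)
  have \<theta>: "\<theta> 1 = ext_T T1" "\<theta> 2 = ext_T T2"
    by (simp_all add: \<theta>_def pair_tuple_def)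
  have double: "?B T1 T2 + ?B T1 T2 = 0 \<longleftrightarrow> ?B T1 T2 = 0"
    using double_eq_0_iff[OF p.vector_space_axioms]
    by (simp add: fun_eq_iff del: One_nat_def)
  have entry: "derived_op 1 structure_cochain [(0, \<theta>), (0, \<theta>)] p =
      (if p = 1 then ?B T1 T1 else if p = 2 then ?B T1 T2 + ?B T2 T1
       else if p = 3 then ?B T2 T2 else 0)" for p
    by (simp only: derived_op_degree_0 \<theta>)
  have "derived_op 1 structure_cochain [(0, \<theta>), (0, \<theta>)] = 0 \<longleftrightarrow>
      ?B T1 T1 = 0 \<and> ?B T1 T2 + ?B T2 T1 = 0 \<and> ?B T2 T2 = 0" (is "?D = 0 \<longleftrightarrow> ?entries")
  proof
    assume "?D = 0"
    then have "?D p = 0" for p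
      by simp
    from this[of 1] this[of 2] this[of 3] show ?entries
      unfolding entry by simp
  next
    assume ?entries
    then have "?D p = 0" for p
      unfolding entry by simp
    then show "?D = 0"
      by (intro ext) (simp only: zero_fun_apply)
  qed
  also have "\<dots> \<longleftrightarrow> (\<forall>u v. O_defect T1 T1 u v = 0) \<and> (\<forall>u v. O_defect T1 T2 u v = 0)
      \<and> (\<forall>u v. O_defect T2 T2 u v = 0)"
    by (simp only: B_sym double B_eq_0 T1 T2)
  also have "\<dots> \<longleftrightarrow> compatible_O_operator sA sM \<mu> l r (T1, T2)"
    using T1 T2 by (auto simp: self mixed compatible_O_operator_def O_operator_def)
  finally show ?thesis .
qed

end


section \<open>Compatible O-operator algebras as Maurer-Cartan elements\<close>

theorem theorem3p12:
  fixes sA :: "'k::field_char_0 \<Rightarrow> 'a::ab_group_add \<Rightarrow> 'a"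
    and sM :: "'k \<Rightarrow> 'm::ab_group_add \<Rightarrow> 'm"
    and \<mu> :: "'a \<Rightarrow> 'a \<Rightarrow> 'a"
    and l :: "'a \<Rightarrow> 'm \<Rightarrow> 'm"
    and r :: "'m \<Rightarrow> 'a \<Rightarrow> 'm"
    and T1 T2 :: "'m \<Rightarrow> 'a"
    and \<pi> :: "('a, 'm) cochain"
  assumes "vector_space sA"
    and "vector_space sM"
    and "bilin sA sA sA \<mu>"
    and "bilin sA sM sM l"
    and "bilin sM sA sM r"
    and "Vector_Spaces.linear sM sA T1"
    and "Vector_Spaces.linear sM sA T2"
    and "\<pi> = ext_\<mu> \<mu> + ext_l l + ext_r r"
  shows "compatible_O_operator_algebra sA sM \<mu> l r (T1, T2) \<longleftrightarrow>
    maurer_cartan (L_scale sA sM) (L_space sA sM) ltilde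
      (\<pi>, pair_tuple (ext_T T1) (ext_T T2))"
proof -
  interpret bilinear_structure_maps sA sM \<mu> l r
    using assms(1-5) by (rule bilinear_structure_maps.intro)
  show ?thesis
    unfolding maurer_cartan_degree_0_iff[OF assms(1,2)] compatible_O_operator_algebra_def assms(8)
      structure_cochain_def[symmetric]
    using in_L_space_0[OF assms(6,7)] gerst_structure_cochain_eq_0_iff
      derived_op_structure_cochain_eq_0_iff[OF assms(6,7)]
    by blast
qed

end
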